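(* Let $n$ be odd and let $G$ be a finite connected graph with a harmonic action of $D_n=\langle\sigma_1,\sigma_2\rangle$ as described in the context, with vertices labeled $z_i^j$ ($1\le j\le s$) and $x_i^j,y_i^j$ ($1\le j\le t$), $i\in\{1,\dots,n\}$. Let $\delta$ be a divisor of degree zero on $G$. Then $\delta\in\mathcal{P}=\mathcal{P}_1+\mathcal{P}_2+\mathcal{P}_3$ if and only if: (1) $\sum_{i=1}^n i\,(X_i+Y_i+Z_i)\equiv 0\pmod n$, where $X_i=\sum_{j=1}^t\delta(x_i^j)$, $Y_i=\sum_{j=1}^t\delta(y_i^j)$, $Z_i=\sum_{j=1}^s\delta(z_i^j)$; and (2) for each $j=1,\dots,t$, $\sum_{i=1}^n\delta(x_i^j)\equiv\sum_{i=1}^n\delta(y_i^j)\pmod n$.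
   Context: Graphs are finite, connected, may have multiple edges, no loops. A divisor on $G$ is a function from the vertex set to $\mathbb{Z}$; its degree is the sum of its values. Setting: $D_n$ is the dihedral group of order $2n$ generated by involutions $\sigma_1,\sigma_2$, acting on $G$ by automorphisms harmonically (no non-identity element fixes both endpoints of an edge), and every $D_n$-orbit of vertices has $n$ or $2n$ points. The vertices are labeled so that there are $s$ orbits of size $n$, $\{z_i^j: i=1,\dots,n\}$ for $j=1,\dots,s$, and $t$ orbits of size $2n$, $\{x_i^j,y_i^j\}$ for $j=1,\dots,t$, with (subscripts mod $n$) $\sigma_1(z_i^j)=z_{n+1-i}^j$, $\sigma_1(x_i^j)=y_{n+1-i}^j$, $\sigma_1(y_i^j)=x_{n+1-i}^j$, $\sigma_2(z_i^j)=z_{n+2-i}^j$, $\sigma_2(x_i^j)=y_{n+2-i}^j$, $\sigma_2(y_i^j)=x_{n+2-i}^j$. For a subgroup $\Gamma$ the quotient graph $G/\Gamma$ has vertices the $\Gamma$-orbits of vertices and edges the $\Gamma$-orbits of edges, quotient map $\phi$; the pullback of a divisor $\hat D$ on $G/\Gamma$ is $\phi^*(\hat D)(v)=|\mathrm{Stab}_\Gamma(v)|\,\hat D(\phi(v))$. Let $H_1=G/\langle\sigma_1\rangle$, $H_2=G/\langle\sigma_2\rangle$, $H_3=G/\langle\sigma_1\sigma_2\rangle$, let $\mathcal{P}_k$ be the set of divisors $\phi_k^*(\hat D)$ with $\hat D$ of degree zero on $H_k$, and $\mathcal{P}_1+\mathcal{P}_2+\mathcal{P}_3$ the set of sums $\delta_1+\delta_2+\delta_3$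 with $\delta_k\in\mathcal{P}_k$. *)

theory Defs
  imports
    "HOL-Algebra.Group_Action"
    "HOL-Algebra.Elementary_Groups"
    "HOL-Number_Theory.Cong"
begin

text \<open>
  Undirected graphs with possible multiple edges: each edge is sent to the set of its endpoints.
  A loop would be an edge whose set of endpoints is a singleton; the record type itself admits
  these, because they can arise in a quotient.
\<close>

record ('v, 'e) multigraph =
  verts :: "'v set"
  edges :: "'e set"
  ends :: "'e \<Rightarrow> 'v set"

definition adj_rel :: "('v, 'e) multigraph \<Rightarrow> 'v rel" where
  "adj_rel G = {(u, v). \<exists>e\<in>edges G. ends G e = {u, v}}"

definition connected_graph :: "('v, 'e) multigraph \<Rightarrow> bool" where
  "connected_graph G \<longleftrightarrow>
     verts G \<noteq> {} \<and> (\<forall>u\<in>verts G. \<forall>v\<in>verts G. (u, v) \<in> (adj_rel G)\<^sup>*)"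

definition finite_loopless_graph :: "('v, 'e) multigraph \<Rightarrow> bool" where
  "finite_loopless_graph G \<longleftrightarrow>
     finite (verts G) \<and> finite (edges G) \<and>
     (\<forall>e\<in>edges G. ends G e \<subseteq> verts G \<and> card (ends G e) = 2)"

definition graph_action ::
  "('g, 'm) monoid_scheme \<Rightarrow> ('v, 'e) multigraph \<Rightarrow> ('g \<Rightarrow> 'v \<Rightarrow> 'v) \<Rightarrow> ('g \<Rightarrow> 'e \<Rightarrow> 'e) \<Rightarrow> bool"
where
  "graph_action \<Gamma> G \<phi> \<psi> \<longleftrightarrow>
     group_action \<Gamma> (verts G) \<phi> \<and> group_action \<Gamma> (edges G) \<psi> \<and>
     (\<forall>g\<in>carrier \<Gamma>. \<forall>e\<in>edges G. ends G (\<psi> g e) = \<phi> g ` ends G e)"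

definition harmonic_action ::
  "('g, 'm) monoid_scheme \<Rightarrow> ('v, 'e) multigraph \<Rightarrow> ('g \<Rightarrow> 'v \<Rightarrow> 'v) \<Rightarrow> ('g \<Rightarrow> 'e \<Rightarrow> 'e) \<Rightarrow> bool"
where
  "harmonic_action \<Gamma> G \<phi> \<psi> \<longleftrightarrow>
     graph_action \<Gamma> G \<phi> \<psi> \<and>
     (\<forall>g\<in>carrier \<Gamma>. \<forall>e\<in>edges G. (\<forall>v\<in>ends G e. \<phi> g v = v) \<longrightarrow> g = \<one>\<^bsub>\<Gamma>\<^esub>)"

definition dihedral_group :: "('g, 'm) monoid_scheme \<Rightarrow> nat \<Rightarrow> 'g \<Rightarrow> 'g \<Rightarrow> bool" where
  "dihedral_group D n \<sigma>\<^sub>1 \<sigma>\<^sub>2 \<longleftrightarrow>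
     group D \<and> order D = 2 * n \<and>
     \<sigma>\<^sub>1 \<in> carrier D \<and> \<sigma>\<^sub>1 \<noteq> \<one>\<^bsub>D\<^esub> \<and> \<sigma>\<^sub>1 \<otimes>\<^bsub>D\<^esub> \<sigma>\<^sub>1 = \<one>\<^bsub>D\<^esub> \<and>
     \<sigma>\<^sub>2 \<in> carrier D \<and> \<sigma>\<^sub>2 \<noteq> \<one>\<^bsub>D\<^esub> \<and> \<sigma>\<^sub>2 \<otimes>\<^bsub>D\<^esub> \<sigma>\<^sub>2 = \<one>\<^bsub>D\<^esub> \<and>
     generate D {\<sigma>\<^sub>1, \<sigma>\<^sub>2} = carrier D"

text \<open>
  The endpoints of an edge orbit are the orbits of the endpoints of any of its members; the union
  over all members avoids choosing a representative.
\<close>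

definition quotient_graph ::
  "('g, 'm) monoid_scheme \<Rightarrow> ('v, 'e) multigraph \<Rightarrow> ('g \<Rightarrow> 'v \<Rightarrow> 'v) \<Rightarrow> ('g \<Rightarrow> 'e \<Rightarrow> 'e)
     \<Rightarrow> ('v set, 'e set) multigraph"
where
  "quotient_graph \<Gamma> G \<phi> \<psi> =
     \<lparr>verts = orbits \<Gamma> (verts G) \<phi>,
      edges = orbits \<Gamma> (edges G) \<psi>,
      ends = (\<lambda>E. orbit \<Gamma> \<phi> ` (\<Union>e\<in>E. ends G e))\<rparr>"

text \<open>
  A function on the vertex set is represented by its extension by zero, so that equality of
  divisors is equality of functions.
\<close>

definition divisors :: "('v, 'e) multigraph \<Rightarrow> ('v \<Rightarrow> int) set" where
  "divisors G = {\<delta>. \<forall>v. v \<notin> verts G \<longrightarrow> \<delta> v = 0}"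

definition divisor_degree :: "('v, 'e) multigraph \<Rightarrow> ('v \<Rightarrow> int) \<Rightarrow> int" where
  "divisor_degree G \<delta> = (\<Sum>v\<in>verts G. \<delta> v)"

definition pullback ::
  "('g, 'm) monoid_scheme \<Rightarrow> ('v, 'e) multigraph \<Rightarrow> ('g \<Rightarrow> 'v \<Rightarrow> 'v) \<Rightarrow> ('v set \<Rightarrow> int) \<Rightarrow> 'v \<Rightarrow> int"
where
  "pullback \<Gamma> G \<phi> \<delta> =
     (\<lambda>v. if v \<in> verts G then int (card (stabilizer \<Gamma> \<phi> v)) * \<delta> (orbit \<Gamma> \<phi> v) else 0)"

definition pullbacks_deg0 ::
  "('g, 'm) monoid_scheme \<Rightarrow> ('v, 'e) multigraph \<Rightarrow> ('g \<Rightarrow> 'v \<Rightarrow> 'v) \<Rightarrow> ('g \<Rightarrow> 'e \<Rightarrow> 'e)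
     \<Rightarrow> ('v \<Rightarrow> int) set"
where
  "pullbacks_deg0 \<Gamma> G \<phi> \<psi> =
     {pullback \<Gamma> G \<phi> \<delta> | \<delta>.
        \<delta> \<in> divisors (quotient_graph \<Gamma> G \<phi> \<psi>) \<and>
        divisor_degree (quotient_graph \<Gamma> G \<phi> \<psi>) \<delta> = 0}"

definition pullback_sum ::
  "('g, 'm) monoid_scheme \<Rightarrow> 'g \<Rightarrow> 'g \<Rightarrow> ('v, 'e) multigraph \<Rightarrow> ('g \<Rightarrow> 'v \<Rightarrow> 'v) \<Rightarrow> ('g \<Rightarrow> 'e \<Rightarrow> 'e)
     \<Rightarrow> ('v \<Rightarrow> int) set"
where
  "pullback_sum D \<sigma>\<^sub>1 \<sigma>\<^sub>2 G \<phi> \<psi> =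
     {(\<lambda>v. \<delta>\<^sub>1 v + \<delta>\<^sub>2 v + \<delta>\<^sub>3 v) | \<delta>\<^sub>1 \<delta>\<^sub>2 \<delta>\<^sub>3.
        \<delta>\<^sub>1 \<in> pullbacks_deg0 (subgroup_generated D {\<sigma>\<^sub>1}) G \<phi> \<psi> \<and>
        \<delta>\<^sub>2 \<in> pullbacks_deg0 (subgroup_generated D {\<sigma>\<^sub>2}) G \<phi> \<psi> \<and>
        \<delta>\<^sub>3 \<in> pullbacks_deg0 (subgroup_generated D {\<sigma>\<^sub>1 \<otimes>\<^bsub>D\<^esub> \<sigma>\<^sub>2}) G \<phi> \<psi>}"

text \<open>
  Subscripts modulo \<open>n\<close> are integers, with labels periodic of period \<open>n\<close> in the subscript. That the
  \<open>n\<close> (resp. \<open>2n\<close>) labels of an orbit are distinct is contained in the cardinalities of the orbits.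
\<close>

definition dihedral_labelling ::
  "('g, 'm) monoid_scheme \<Rightarrow> nat \<Rightarrow> 'g \<Rightarrow> 'g \<Rightarrow> ('v, 'e) multigraph \<Rightarrow> ('g \<Rightarrow> 'v \<Rightarrow> 'v)
     \<Rightarrow> nat \<Rightarrow> nat \<Rightarrow> (int \<Rightarrow> nat \<Rightarrow> 'v) \<Rightarrow> (int \<Rightarrow> nat \<Rightarrow> 'v) \<Rightarrow> (int \<Rightarrow> nat \<Rightarrow> 'v) \<Rightarrow> bool"
where
  "dihedral_labelling D n \<sigma>\<^sub>1 \<sigma>\<^sub>2 G \<phi> s t z x y \<longleftrightarrow>
     bij_betw (\<lambda>j. {z i j | i. i \<in> {1..int n}})
       {1..s} {B \<in> orbits D (verts G) \<phi>. card B = n} \<and>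
     bij_betw (\<lambda>j. {x i j | i. i \<in> {1..int n}} \<union> {y i j | i. i \<in> {1..int n}})
       {1..t} {B \<in> orbits D (verts G) \<phi>. card B = 2 * n} \<and>
     (\<forall>j\<in>{1..s}. \<forall>i.
        z (i + int n) j = z i j \<and>
        \<phi> \<sigma>\<^sub>1 (z i j) = z (int n + 1 - i) j \<and>
        \<phi> \<sigma>\<^sub>2 (z i j) = z (int n + 2 - i) j) \<and>
     (\<forall>j\<in>{1..t}. \<forall>i.
        x (i + int n) j = x i j \<and> y (i + int n) j = y i j \<and>
        \<phi> \<sigma>\<^sub>1 (x i j) = y (int n + 1 - i) j \<and> \<phi> \<sigma>\<^sub>1 (y i j) = x (int n + 1 - i) j \<and>
        \<phi> \<sigma>\<^sub>2 (x i j) = y (int n + 2 - i) j \<and> \<phi> \<sigma>\<^sub>2 (y i j) = x (int n + 2 - i) j)"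

end

theory Submission
  imports Defs "HOL-Algebra.Multiplicative_Group" "HOL-Library.Periodic_Fun"
begin

text \<open>
  The pullback of the pushforward of a divisor \<open>h\<close> on \<open>G\<close> is its trace, the sum of the
  \<open>\<Gamma>\<close>-translates of \<open>h\<close>. As pushforward is surjective and preserves the degree, \<open>P\<^sub>k\<close> is the set of
  traces of divisors of degree zero. Index the vertices by \<open>C \<times> \<int>/n\<close>, where the mirror involution
  of \<open>C\<close> exchanges \<open>x\<^sup>j\<close> and \<open>y\<^sup>j\<close> and fixes \<open>z\<^sup>j\<close>. Then the traces are
  \<open>T\<^sub>k h(c, i) = h(c, i) + h(mirror c, k - i)\<close> for \<open>k = 1, 2\<close>, and \<open>T\<^sub>3 h(c, i) = \<Sum>\<^sub>k h(c, k)\<close>.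
  Conditions (1) and (2) say that the weight \<open>\<Sum> i \<delta>(c, i)\<close> is \<open>0\<close> modulo \<open>n\<close> and that the sums
  of \<open>\<delta>\<close> over mirrored cycles are congruent.

  Both conditions are necessary, because modulo \<open>n\<close> the weight of \<open>T\<^sub>k h\<close> is \<open>k deg h\<close> for
  \<open>k = 1, 2\<close>, and that of \<open>T\<^sub>3 h\<close> is \<open>0\<close>. Conversely, write \<open>n = 2 m + 1\<close>. By (2) there is an
  array \<open>b\<close> of degree zero such that \<open>f = \<delta> + m T\<^sub>1 \<delta> - T\<^sub>3 b\<close> sums to zero over every cycle.
  Summing \<open>f\<close> along the cycles gives \<open>f = T\<^sub>2 h - T\<^sub>1 h\<close> for some \<open>h\<close>. The degree of \<open>h\<close> is congruent
  to the weight of \<open>f\<close>, hence to \<open>0\<close> by (1), so subtracting a constant from \<open>h\<close> on one cycle makes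
  it zero.
\<close>

section \<open>Sums of periodic functions\<close>

lemma periodic_cong:
  assumes "periodic_fun_simple f (int n)" and "[i = k] (mod int n)"
  shows "f i = f k"
proof -
  interpret periodic_fun_simple f "int n" by fact
  obtain q where "k = i + int n * q"
    using assms(2) by (auto simp: cong_iff_lin)
  then show ?thesis
    using plus_of_int[of i q] by (simp add: mult.commute)
qed

lemma sum_periodic_residue_system:
  fixes f :: "int \<Rightarrow> 'a :: comm_monoid_add"
  assumes "periodic_fun_simple f (int n)" and "n > 0"
    and "card I = n" and inj: "inj_on (\<lambda>i. r i mod int n) I"
  shows "(\<Sum>i\<in>I. f (r i)) = (\<Sum>i=0..<int n. f i)"
proof -
  have "(\<lambda>i. r i mod int n) ` I = {0..<int n}"
    using assms by (intro card_subset_eq) (auto simp: card_image)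
  then have "(\<Sum>i=0..<int n. f i) = (\<Sum>i\<in>I. f (r i mod int n))"
    using inj by (metis (no_types, lifting) sum.reindex_cong)
  also have "\<dots> = (\<Sum>i\<in>I. f (r i))"
    by (intro sum.cong refl periodic_cong[OF assms(1)]) (simp add: cong_def)
  finally show ?thesis by simp
qed

lemma inj_on_mod_int:
  assumes inj: "inj_on r I" and close: "\<And>i k. i \<in> I \<Longrightarrow> k \<in> I \<Longrightarrow> \<bar>r i - r k\<bar> < int n"
  shows "inj_on (\<lambda>i. r i mod int n) I"
proof (rule inj_onI)
  fix i k assume i_k_in: "i \<in> I" "k \<in> I" and "r i mod int n = r k mod int n"
  then have "int n dvd r i - r k" by (simp add: mod_eq_dvd_iff)
  then have "r i = r k" using close[OF i_k_in] dvd_imp_le_int[of "r i - r k" "int n"] by auto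
  then show "i = k" using inj i_k_in by (simp add: inj_on_eq_iff)
qed

lemma sum_periodic_reindex:
  fixes f :: "int \<Rightarrow> 'a :: comm_monoid_add"
  assumes "periodic_fun_simple f (int n)" and "n > 0" and "card I = n"
    and "inj_on r I" and "\<And>i k. i \<in> I \<Longrightarrow> k \<in> I \<Longrightarrow> \<bar>r i - r k\<bar> < int n"
  shows "(\<Sum>i\<in>I. f (r i)) = (\<Sum>i=1..int n. f i)"
proof -
  have "(\<Sum>i\<in>I. f (r i)) = (\<Sum>i=0..<int n. f i)"
    using assms by (intro sum_periodic_residue_system inj_on_mod_int)
  also have "\<dots> = (\<Sum>i=1..int n. f i)"
    using assms(1,2) by (intro sum_periodic_residue_system[symmetric] inj_on_mod_int) auto
  finally show ?thesis .
qed

lemma sum_periodic_reflect: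
  fixes f :: "int \<Rightarrow> 'a :: comm_monoid_add"
  assumes "periodic_fun_simple f (int n)" and "n > 0"
  shows "(\<Sum>i=1..int n. f (k - i)) = (\<Sum>i=1..int n. f i)"
  by (rule sum_periodic_reindex[OF assms]) (auto simp: inj_on_def)

lemma weighted_sum_periodic_reflect:
  fixes f :: "int \<Rightarrow> int"
  assumes "periodic_fun_simple f (int n)" and "n > 0"
  shows "[(\<Sum>i=1..int n. i * f (k - i)) = (\<Sum>i=1..int n. (k - i) * f i)] (mod int n)"
proof -
  have "[(\<Sum>i=1..int n. i * f (k - i))
      = (\<Sum>i=1..int n. (k - (k - i)) mod int n * f (k - i))] (mod int n)"
    by (intro cong_sum cong_mult) (simp_all add: cong_def)
  also have "(\<Sum>i=1..int n. (k - (k - i)) mod int n * f (k - i))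
      = (\<Sum>i=1..int n. (k - i) mod int n * f i)"
  proof (rule sum_periodic_reflect)
    show "periodic_fun_simple (\<lambda>i. (k - i) mod int n * f i) (int n)"
      using assms(1) by (simp add: periodic_fun_simple_def diff_diff_eq[symmetric])
  qed fact
  also have "[(\<Sum>i=1..int n. (k - i) mod int n * f i) = (\<Sum>i=1..int n. (k - i) * f i)] (mod int n)"
    by (intro cong_sum cong_mult) (simp_all add: cong_def)
  finally show ?thesis .
qed

lemma periodic_antidifference:
  fixes f :: "int \<Rightarrow> 'a :: ab_group_add"
  assumes per: "periodic_fun_simple f (int n)" and "n > 0" and zero: "(\<Sum>i=1..int n. f i) = 0"
  obtains F where "periodic_fun_simple F (int n)" and "\<And>i. F i - F (i - 1) = f i"
proof
  define F where "F i = (\<Sum>k=1..i mod int n. f k)" for i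
  show "periodic_fun_simple F (int n)"
    by (simp add: periodic_fun_simple_def F_def)
  fix i
  define r where "r = i mod int n"
  have r_bounds: "0 \<le> r" "r < int n"
    using \<open>n > 0\<close> by (simp_all add: r_def)
  have f_r: "f r = f i"
    by (rule periodic_cong[OF per]) (simp add: r_def cong_def)
  have pred_mod: "(i - 1) mod int n = (r - 1) mod int n"
    by (simp add: r_def mod_simps)
  show "F i - F (i - 1) = f i"
  proof (cases "r = 0")
    case True
    have "[int n = i] (mod int n)"
      using True by (simp add: r_def cong_def)
    then have "f (int n) = f i"
      by (rule periodic_cong[OF per])
    moreover have "(i - 1) mod int n = int n - 1"
      using True \<open>n > 0\<close> by (simp add: pred_mod zmod_minus1)
    moreover have "{1..int n} = insert (int n) {1..int n - 1}"
      using \<open>n > 0\<close> by auto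
    ultimately show ?thesis
      using True zero by (simp add: F_def r_def[symmetric] add_eq_0_iff)
  next
    case False
    then have "(i - 1) mod int n = r - 1"
      using r_bounds by (simp add: pred_mod)
    moreover have "{1..r} = insert r {1..r - 1}"
      using r_bounds False by auto
    ultimately show ?thesis
      by (simp add: F_def r_def[symmetric] f_r)
  qed
qed

section \<open>Arrays on mirrored cycles\<close>

locale mirrored_cycles =
  fixes n :: nat and C :: "'c set" and mirror :: "'c \<Rightarrow> 'c"
  assumes odd_n: "odd n"
    and finite_C: "finite C" and C_nonempty: "C \<noteq> {}"
    and mirror_closed: "c \<in> C \<Longrightarrow> mirror c \<in> C"
    and mirror_mirror: "c \<in> C \<Longrightarrow> mirror (mirror c) = c"
begin

lemma n_pos: "n > 0"
  using odd_n by (rule odd_pos)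

definition periodic_array :: "('c \<Rightarrow> int \<Rightarrow> int) \<Rightarrow> bool" where
  "periodic_array a \<longleftrightarrow> (\<forall>c\<in>C. periodic_fun_simple (a c) (int n))"

definition cycle_sum :: "('c \<Rightarrow> int \<Rightarrow> int) \<Rightarrow> 'c \<Rightarrow> int" where
  "cycle_sum a c = (\<Sum>i=1..int n. a c i)"

definition total :: "('c \<Rightarrow> int \<Rightarrow> int) \<Rightarrow> int" where
  "total a = (\<Sum>c\<in>C. cycle_sum a c)"

definition weight :: "('c \<Rightarrow> int \<Rightarrow> int) \<Rightarrow> int" where
  "weight a = (\<Sum>c\<in>C. \<Sum>i=1..int n. i * a c i)"

definition reflection_trace :: "int \<Rightarrow> ('c \<Rightarrow> int \<Rightarrow> int) \<Rightarrow> 'c \<Rightarrow> int \<Rightarrow> int" where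
  "reflection_trace k a c i = a c i + a (mirror c) (k - i)"

definition rotation_trace :: "('c \<Rightarrow> int \<Rightarrow> int) \<Rightarrow> 'c \<Rightarrow> int \<Rightarrow> int" where
  "rotation_trace a c i = cycle_sum a c"

definition zero_total_arrays :: "('c \<Rightarrow> int \<Rightarrow> int) set" where
  "zero_total_arrays = {a. periodic_array a \<and> total a = 0}"

definition is_trace_sum :: "('c \<Rightarrow> int \<Rightarrow> int) \<Rightarrow> bool" where
  "is_trace_sum d \<longleftrightarrow> (\<exists>a\<^sub>1\<in>zero_total_arrays. \<exists>a\<^sub>2\<in>zero_total_arrays. \<exists>a\<^sub>3\<in>zero_total_arrays. \<forall>c\<in>C. \<forall>i.
     d c i = reflection_trace 1 a\<^sub>1 c i + reflection_trace 2 a\<^sub>2 c i + rotation_trace a\<^sub>3 c i)"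

definition balanced :: "('c \<Rightarrow> int \<Rightarrow> int) \<Rightarrow> bool" where
  "balanced a \<longleftrightarrow> (\<forall>c\<in>C. [cycle_sum a c = cycle_sum a (mirror c)] (mod int n))"

lemma sum_mirror: "(\<Sum>c\<in>C. f (mirror c)) = (\<Sum>c\<in>C. f c)"
  by (rule sum.reindex_bij_witness[where i=mirror and j=mirror])
     (auto simp: mirror_closed mirror_mirror)

lemma periodic_array_reflect:
  assumes "periodic_array a"
  shows "periodic_array (\<lambda>c i. a (mirror c) (k - i))"
  unfolding periodic_array_def periodic_fun_simple_def
proof (intro ballI allI)
  fix c i assume "c \<in> C"
  then interpret periodic_fun_simple "a (mirror c)" "int n"
    using assms mirror_closed by (simp add: periodic_array_def)
  show "a (mirror c) (k - (i + int n)) = a (mirror c) (k - i)"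
    using minus_1[of "k - i"] by (simp add: diff_diff_eq)
qed

lemma periodic_reflection_trace:
  assumes "periodic_array a"
  shows "periodic_array (reflection_trace k a)"
  using assms periodic_array_reflect[OF assms, of k]
  by (simp add: periodic_array_def periodic_fun_simple_def reflection_trace_def)

lemma periodic_rotation_trace: "periodic_array (rotation_trace a)"
  by (simp add: periodic_array_def periodic_fun_simple_def rotation_trace_def)

lemma cycle_sum_reflection_trace:
  assumes "periodic_array a" and "c \<in> C"
  shows "cycle_sum (reflection_trace k a) c = cycle_sum a c + cycle_sum a (mirror c)"
  using assms sum_periodic_reflect[OF _ n_pos, of "a (mirror c)" k] mirror_closed
  by (simp add: cycle_sum_def reflection_trace_def sum.distrib periodic_array_def)

lemma cycle_sum_rotation_trace: "cycle_sum (rotation_trace a) c = int n * cycle_sum a c"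
  by (simp add: cycle_sum_def[of "rotation_trace a"] rotation_trace_def)

lemma weight_reflection_trace:
  assumes "periodic_array a"
  shows "[weight (reflection_trace k a) = k * total a] (mod int n)"
proof -
  have "weight (reflection_trace k a)
      = weight a + (\<Sum>c\<in>C. \<Sum>i=1..int n. i * a (mirror c) (k - i))"
    by (simp add: weight_def reflection_trace_def distrib_left sum.distrib)
  also have "\<dots> = weight a + (\<Sum>c\<in>C. \<Sum>i=1..int n. i * a c (k - i))"
    by (simp add: sum_mirror[of "\<lambda>c. \<Sum>i=1..int n. i * a c (k - i)"])
  also have "[\<dots> = weight a + (\<Sum>c\<in>C. \<Sum>i=1..int n. (k - i) * a c i)] (mod int n)"
    using assms n_pos
    by (intro cong_add cong_sum weighted_sum_periodic_reflect) (simp_all add: periodic_array_def)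
  also have "weight a + (\<Sum>c\<in>C. \<Sum>i=1..int n. (k - i) * a c i) = k * total a"
    by (simp add: weight_def total_def cycle_sum_def left_diff_distrib sum_subtractf
        sum_distrib_left)
  finally show ?thesis .
qed

lemma weight_rotation_trace: "[weight (rotation_trace a) = 0] (mod int n)"
proof -
  have "(\<Sum>i=1..int n. i) = int n * ((int n + 1) div 2)"
    using odd_n n_pos by (simp add: Sum_Icc_int div_mult_swap[symmetric])
  then have "int n dvd weight (rotation_trace a)"
    by (auto simp: weight_def rotation_trace_def sum_distrib_right[symmetric] intro!: dvd_sum)
  then show ?thesis by (simp add: cong_0_iff)
qed

lemma is_trace_sum_weight_balanced:
  assumes "is_trace_sum d"
  shows "[weight d = 0] (mod int n)" and "balanced d"
proof -
  obtain a\<^sub>1 a\<^sub>2 a\<^sub>3 where a: "periodic_array a\<^sub>1" "periodic_array a\<^sub>2" "total a\<^sub>1 = 0" "total a\<^sub>2 = 0"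
    and d: "\<forall>c\<in>C. \<forall>i. d c i
      = reflection_trace 1 a\<^sub>1 c i + reflection_trace 2 a\<^sub>2 c i + rotation_trace a\<^sub>3 c i"
    using assms by (auto simp: is_trace_sum_def zero_total_arrays_def)
  have "weight d = weight (reflection_trace 1 a\<^sub>1) + weight (reflection_trace 2 a\<^sub>2)
      + weight (rotation_trace a\<^sub>3)"
    using d by (simp add: weight_def distrib_left sum.distrib)
  also have "[\<dots> = 1 * total a\<^sub>1 + 2 * total a\<^sub>2 + 0] (mod int n)"
    by (intro cong_add weight_reflection_trace weight_rotation_trace a)
  finally show "[weight d = 0] (mod int n)" by (simp add: a)
  have cycle_sum_d: "cycle_sum d c = (cycle_sum a\<^sub>1 c + cycle_sum a\<^sub>1 (mirror c))
      + (cycle_sum a\<^sub>2 c + cycle_sum a\<^sub>2 (mirror c)) + int n * cycle_sum a\<^sub>3 c" if "c \<in> C" for c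
  proof -
    have "cycle_sum d c = cycle_sum (reflection_trace 1 a\<^sub>1) c + cycle_sum (reflection_trace 2 a\<^sub>2) c
        + cycle_sum (rotation_trace a\<^sub>3) c"
      using d that by (simp add: cycle_sum_def sum.distrib)
    then show ?thesis
      using that a by (simp add: cycle_sum_reflection_trace cycle_sum_rotation_trace)
  qed
  then show "balanced d"
    by (simp add: balanced_def mirror_closed mirror_mirror cong_iff_dvd_diff
        right_diff_distrib[symmetric])
qed

lemma zero_cycle_sums_trace_difference:
  assumes "periodic_array f" and "\<forall>c\<in>C. cycle_sum f c = 0"
  obtains h where "periodic_array h"
    and "\<forall>c\<in>C. \<forall>i. f c i = reflection_trace 2 h c i - reflection_trace 1 h c i"
proof -
  have "\<exists>F. periodic_fun_simple F (int n) \<and> (\<forall>i. f c i = F i - F (i - 1))" if "c \<in> C" for c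
  proof -
    have "periodic_fun_simple (f c) (int n)" "(\<Sum>i=1..int n. f c i) = 0"
      using assms that by (simp_all add: periodic_array_def cycle_sum_def)
    then obtain F where "periodic_fun_simple F (int n)" "\<And>i. F i - F (i - 1) = f c i"
      using n_pos periodic_antidifference by blast
    then show ?thesis by auto
  qed
  then obtain F where F: "\<And>c. c \<in> C \<Longrightarrow>
      periodic_fun_simple (F c) (int n) \<and> (\<forall>i. f c i = F c i - F c (i - 1))"
    by metis
  define h where "h c i = - F (mirror c) (1 - i)" for c i
  show ?thesis
  proof
    have "periodic_array (\<lambda>c i. F (mirror c) (1 - i))"
      using F by (intro periodic_array_reflect) (simp add: periodic_array_def)
    then show "periodic_array h"
      by (simp add: periodic_array_def periodic_fun_simple_def h_def)
    show "\<forall>c\<in>C. \<forall>i. f c i = reflection_trace 2 h c i - reflection_trace 1 h c i"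
      using F by (simp add: reflection_trace_def h_def mirror_mirror)
  qed
qed

text \<open>
  The weight of \<open>f\<close> is congruent to the total of the array \<open>h\<close> just constructed. Adding a constant
  on one cycle changes the total by a multiple of \<open>n\<close> but not the difference of the two traces.
\<close>

lemma zero_cycle_sums_weight_trace_difference:
  assumes "periodic_array f" and "\<forall>c\<in>C. cycle_sum f c = 0" and "[weight f = 0] (mod int n)"
  obtains h where "h \<in> zero_total_arrays"
    and "\<forall>c\<in>C. \<forall>i. f c i = reflection_trace 2 h c i - reflection_trace 1 h c i"
proof -
  obtain h where h: "periodic_array h"
    and f_eq: "\<forall>c\<in>C. \<forall>i. f c i = reflection_trace 2 h c i - reflection_trace 1 h c i"
    using zero_cycle_sums_trace_difference assms(1,2) by blast
  have "weight f = weight (reflection_trace 2 h) - weight (reflection_trace 1 h)"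
    using f_eq by (simp add: weight_def right_diff_distrib sum_subtractf)
  also have "[\<dots> = 2 * total h - 1 * total h] (mod int n)"
    by (intro cong_diff weight_reflection_trace h)
  finally have "[total h = 0] (mod int n)"
    using assms(3) by (simp add: cong_def)
  then obtain k where k: "total h = int n * k"
    by (auto simp: cong_0_iff)
  obtain c\<^sub>0 where "c\<^sub>0 \<in> C" using C_nonempty by blast
  define h' where "h' c i = h c i - (if c = c\<^sub>0 then k else 0)" for c i
  have "total h' = total h - (\<Sum>c\<in>C. if c = c\<^sub>0 then int n * k else 0)"
    by (simp add: total_def cycle_sum_def h'_def sum_subtractf if_distrib[of "(*) _"] cong: if_cong)
  then have "total h' = 0"
    using k \<open>c\<^sub>0 \<in> C\<close> finite_C by simp
  moreover have "periodic_array h'"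
    using h by (simp add: periodic_array_def periodic_fun_simple_def h'_def)
  moreover have "\<forall>c\<in>C. \<forall>i. f c i = reflection_trace 2 h' c i - reflection_trace 1 h' c i"
    using f_eq by (simp add: reflection_trace_def h'_def)
  ultimately show ?thesis
    using that by (simp add: zero_total_arrays_def)
qed

lemma ex_array_cycle_sum:
  obtains b where "periodic_array b" and "\<And>c. cycle_sum b c = S c"
proof
  define b where "b c i = (if int n dvd i then S c else 0)" for c i
  show "periodic_array b"
    by (simp add: periodic_array_def periodic_fun_simple_def b_def)
  fix c
  have "int n dvd i \<longleftrightarrow> i = int n" if "i \<in> {1..int n}" for i
    using that zdvd_imp_le[of "int n" i] by auto
  then have "cycle_sum b c = (\<Sum>i=1..int n. if i = int n then S c else 0)"
    unfolding cycle_sum_def b_def by (intro sum.cong) auto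
  then show "cycle_sum b c = S c"
    using n_pos by simp
qed

text \<open>
  If \<open>n = 2 m + 1\<close> and the sums of \<open>d\<close> over a cycle and its mirror image are \<open>S\<close> and \<open>S - n q\<close>, then
  \<open>b\<close> has cycle sum \<open>S - m q\<close>, because \<open>S + m (S + (S - n q)) = n (S - m q)\<close>.
\<close>

lemma balanced_cancel_cycle_sums:
  assumes d: "periodic_array d" and "balanced d"
  obtains b m f where "periodic_array b" and "total b = total d"
    and "f = (\<lambda>c i. d c i + m * reflection_trace 1 d c i - rotation_trace b c i)"
    and "\<forall>c\<in>C. cycle_sum f c = 0"
proof -
  obtain m where n_eq: "int n = 2 * m + 1"
    using odd_n by (auto elim: oddE)
  define q where "q c = (cycle_sum d c - cycle_sum d (mirror c)) div int n" for c
  have q: "int n * q c = cycle_sum d c - cycle_sum d (mirror c)" if "c \<in> C" for c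
    using \<open>balanced d\<close> that by (simp add: q_def balanced_def cong_iff_dvd_diff)
  have "int n * (\<Sum>c\<in>C. q c) = (\<Sum>c\<in>C. cycle_sum d c) - (\<Sum>c\<in>C. cycle_sum d (mirror c))"
    by (simp add: sum_distrib_left q sum_subtractf)
  then have sum_q: "(\<Sum>c\<in>C. q c) = 0"
    using n_pos by (simp add: sum_mirror[of "cycle_sum d"])
  obtain b where b: "periodic_array b" "\<And>c. cycle_sum b c = cycle_sum d c - m * q c"
    using ex_array_cycle_sum[of "\<lambda>c. cycle_sum d c - m * q c"] by blast
  define f where "f = (\<lambda>c i. d c i + m * reflection_trace 1 d c i - rotation_trace b c i)"
  have "cycle_sum f c = 0" if "c \<in> C" for c
  proof -
    have "cycle_sum f c
        = cycle_sum d c + m * cycle_sum (reflection_trace 1 d) c - cycle_sum (rotation_trace b) c"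
      by (simp add: cycle_sum_def f_def sum.distrib sum_subtractf sum_distrib_left)
    also have "\<dots> = cycle_sum d c + m * (cycle_sum d c + cycle_sum d (mirror c))
        - int n * cycle_sum d c + m * (int n * q c)"
      by (simp add: cycle_sum_reflection_trace[OF d that] cycle_sum_rotation_trace b(2)
          algebra_simps)
    also have "\<dots> = 0"
      unfolding q[OF that] by (simp add: n_eq algebra_simps)
    finally show ?thesis .
  qed
  moreover have "total b = total d"
    using sum_q by (simp add: total_def b(2) sum_subtractf sum_distrib_left[symmetric])
  ultimately show ?thesis
    using that b(1) f_def by blast
qed

lemma is_trace_sumI:
  assumes d: "d \<in> zero_total_arrays" and weight_d: "[weight d = 0] (mod int n)" and "balanced d"
  shows "is_trace_sum d"
proof -
  have periodic_d: "periodic_array d" and total_d: "total d = 0"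
    using d by (simp_all add: zero_total_arrays_def)
  obtain b m f where b: "periodic_array b" "total b = total d"
    and f: "f = (\<lambda>c i. d c i + m * reflection_trace 1 d c i - rotation_trace b c i)"
    and cycle_sum_f: "\<forall>c\<in>C. cycle_sum f c = 0"
    by (rule balanced_cancel_cycle_sums[OF periodic_d \<open>balanced d\<close>])
  have "weight f = weight d + m * weight (reflection_trace 1 d) - weight (rotation_trace b)"
    by (simp add: weight_def f distrib_left right_diff_distrib mult.left_commute[of _ m]
        sum.distrib sum_subtractf sum_distrib_left)
  also have "[\<dots> = 0 + m * (1 * total d) - 0] (mod int n)"
    by (intro cong_add cong_diff cong_scalar_left weight_reflection_trace weight_rotation_trace
        periodic_d weight_d)
  finally have weight_f: "[weight f = 0] (mod int n)"
    by (simp add: total_d)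
  have periodic_f: "periodic_array f"
    using periodic_d periodic_reflection_trace[OF periodic_d, of 1] periodic_rotation_trace[of b]
    by (simp add: periodic_array_def periodic_fun_simple_def f)
  obtain h where h: "h \<in> zero_total_arrays"
    and f_eq: "\<forall>c\<in>C. \<forall>i. f c i = reflection_trace 2 h c i - reflection_trace 1 h c i"
    by (rule zero_cycle_sums_weight_trace_difference[OF periodic_f cycle_sum_f weight_f])
  define a where "a c i = - m * d c i - h c i" for c i
  have "total a = - m * total d - total h"
    by (simp add: total_def cycle_sum_def a_def sum_negf sum_subtractf sum_distrib_left)
  then have "a \<in> zero_total_arrays"
    using d h by (simp add: zero_total_arrays_def periodic_array_def periodic_fun_simple_def a_def)
  moreover have "b \<in> zero_total_arrays"
    using b total_d by (simp add: zero_total_arrays_def)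
  moreover have "d c i = reflection_trace 1 a c i + reflection_trace 2 h c i + rotation_trace b c i"
    if "c \<in> C" for c i
    using f_eq[rule_format, OF that, of i] by (simp add: f reflection_trace_def a_def algebra_simps)
  ultimately show ?thesis
    using h unfolding is_trace_sum_def by blast
qed

theorem is_trace_sum_iff:
  assumes "d \<in> zero_total_arrays"
  shows "is_trace_sum d \<longleftrightarrow> [weight d = 0] (mod int n) \<and> balanced d"
  using is_trace_sum_weight_balanced is_trace_sumI[OF assms] by blast

end

section \<open>Pullbacks as traces\<close>

lemma (in group_action) orbit_eq:
  assumes "B \<in> orbits G E \<phi>" and "v \<in> B"
  shows "v \<in> E" and "orbit G \<phi> v = B"
proof -
  show "v \<in> E" using assms orbits_coverture by blast
  then have "orbit G \<phi> v \<in> orbits G E \<phi>" and "v \<in> orbit G \<phi> v"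
    using orbit_refl by (auto simp: orbits_def)
  then show "orbit G \<phi> v = B" using assms disjoint_union by blast
qed

lemma (in group_action) card_transporter:
  assumes "v \<in> E" and "h \<in> carrier G"
  shows "card {g \<in> carrier G. \<phi> g v = \<phi> h v} = card (stabilizer G \<phi> v)"
proof -
  interpret group G using group_hom group_hom.axioms(1) by blast
  have "{g \<in> carrier G. \<phi> g v = \<phi> h v} = (\<lambda>g. h \<otimes> g) ` stabilizer G \<phi> v"
  proof (intro equalityI subsetI)
    fix g assume "g \<in> {g \<in> carrier G. \<phi> g v = \<phi> h v}"
    then have "g \<in> carrier G" "\<phi> g v = \<phi> h v" by auto
    then have "inv h \<otimes> g \<in> stabilizer G \<phi> v" and "g = h \<otimes> (inv h \<otimes> g)"
      using assms composition_rule orbit_sym_aux[OF assms(2,1)]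
      by (simp_all add: stabilizer_def m_assoc[symmetric])
    then show "g \<in> (\<lambda>g. h \<otimes> g) ` stabilizer G \<phi> v" by blast
  qed (use assms composition_rule in \<open>auto simp: stabilizer_def\<close>)
  moreover have "inj_on (\<lambda>g. h \<otimes> g) (stabilizer G \<phi> v)"
    using inj_on_cmult[OF assms(2)] stabilizer_subset by (rule inj_on_subset)
  ultimately show ?thesis by (simp add: card_image)
qed

lemma (in group_action) sum_over_group:
  fixes f :: "_ \<Rightarrow> 'r :: semiring_1"
  assumes "finite (carrier G)" and "v \<in> E"
  shows "(\<Sum>g\<in>carrier G. f (\<phi> g v)) = of_nat (card (stabilizer G \<phi> v)) * (\<Sum>w\<in>orbit G \<phi> v. f w)"
proof -
  have "(\<Sum>g\<in>carrier G. f (\<phi> g v))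
      = (\<Sum>w\<in>(\<lambda>g. \<phi> g v) ` carrier G. \<Sum>g\<in>{g \<in> carrier G. \<phi> g v = w}. f (\<phi> g v))"
    by (rule sum.image_gen[OF assms(1)])
  also have "\<dots> = (\<Sum>w\<in>(\<lambda>g. \<phi> g v) ` carrier G. of_nat (card (stabilizer G \<phi> v)) * f w)"
    by (intro sum.cong refl) (auto simp: card_transporter[OF assms(2)])
  also have "(\<lambda>g. \<phi> g v) ` carrier G = orbit G \<phi> v"
    by (auto simp: orbit_def)
  finally show ?thesis by (simp add: sum_distrib_left)
qed

definition divisor_trace ::
  "('g, 'm) monoid_scheme \<Rightarrow> ('v, 'e) multigraph \<Rightarrow> ('g \<Rightarrow> 'v \<Rightarrow> 'v) \<Rightarrow> ('v \<Rightarrow> int) \<Rightarrow> 'v \<Rightarrow> int"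
where
  "divisor_trace \<Gamma> G \<phi> \<delta> = (\<lambda>v. if v \<in> verts G then \<Sum>g\<in>carrier \<Gamma>. \<delta> (\<phi> g v) else 0)"

definition pushforward ::
  "('g, 'm) monoid_scheme \<Rightarrow> ('v, 'e) multigraph \<Rightarrow> ('g \<Rightarrow> 'v \<Rightarrow> 'v) \<Rightarrow> ('v \<Rightarrow> int) \<Rightarrow> 'v set \<Rightarrow> int"
where
  "pushforward \<Gamma> G \<phi> \<delta> = (\<lambda>B. if B \<in> orbits \<Gamma> (verts G) \<phi> then \<Sum>v\<in>B. \<delta> v else 0)"

lemma pullback_pushforward:
  assumes "group_action \<Gamma> (verts G) \<phi>" and "finite (carrier \<Gamma>)"
  shows "pullback \<Gamma> G \<phi> (pushforward \<Gamma> G \<phi> \<delta>) = divisor_trace \<Gamma> G \<phi> \<delta>"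
proof -
  interpret group_action \<Gamma> "verts G" \<phi> by fact
  show ?thesis
    by (auto simp: fun_eq_iff pullback_def pushforward_def divisor_trace_def orbits_def
        sum_over_group[OF assms(2)])
qed

lemma divisor_degree_pushforward:
  assumes "group_action \<Gamma> (verts G) \<phi>" and "finite (verts G)"
  shows "divisor_degree (quotient_graph \<Gamma> G \<phi> \<psi>) (pushforward \<Gamma> G \<phi> \<delta>) = divisor_degree G \<delta>"
  using group_action.disjoint_sum[OF assms]
  by (simp add: divisor_degree_def quotient_graph_def pushforward_def)

lemma pushforward_in_divisors: "pushforward \<Gamma> G \<phi> \<delta> \<in> divisors (quotient_graph \<Gamma> G \<phi> \<psi>)"
  by (simp add: divisors_def quotient_graph_def pushforward_def)

lemma pushforward_surj:
  assumes "group_action \<Gamma> (verts G) \<phi>" and "finite (verts G)"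
    and \<delta>: "\<delta> \<in> divisors (quotient_graph \<Gamma> G \<phi> \<psi>)"
  obtains \<epsilon> where "\<epsilon> \<in> divisors G" and "pushforward \<Gamma> G \<phi> \<epsilon> = \<delta>"
proof -
  interpret group_action \<Gamma> "verts G" \<phi> by fact
  have "\<exists>v. v \<in> B" if "B \<in> orbits \<Gamma> (verts G) \<phi>" for B
    using that orbit_refl by (auto simp: orbits_def)
  then obtain r where r: "\<And>B. B \<in> orbits \<Gamma> (verts G) \<phi> \<Longrightarrow> r B \<in> B"
    by metis
  define \<epsilon> where "\<epsilon> v = (if v \<in> verts G \<and> v = r (orbit \<Gamma> \<phi> v) then \<delta> (orbit \<Gamma> \<phi> v) else 0)" for v
  have "pushforward \<Gamma> G \<phi> \<epsilon> B = \<delta> B" for B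
  proof (cases "B \<in> orbits \<Gamma> (verts G) \<phi>")
    case True
    then have "B \<subseteq> verts G" using orbits_coverture by blast
    then have "finite B" using assms(2) finite_subset by blast
    have "(\<Sum>v\<in>B. \<epsilon> v) = (\<Sum>v\<in>B. if v = r B then \<delta> B else 0)"
      using orbit_eq[OF True] orbit_eq(2)[OF True r[OF True]]
      by (intro sum.cong refl) (auto simp: \<epsilon>_def)
    then show ?thesis
      using True r \<open>finite B\<close> by (simp add: pushforward_def)
  next
    case False
    then show ?thesis using \<delta> by (simp add: pushforward_def divisors_def quotient_graph_def)
  qed
  then show ?thesis
    by (intro that[of \<epsilon>]) (auto simp: \<epsilon>_def divisors_def)
qed

definition degree_zero_divisors :: "('v, 'e) multigraph \<Rightarrow> ('v \<Rightarrow> int) set" where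
  "degree_zero_divisors G = {\<delta> \<in> divisors G. divisor_degree G \<delta> = 0}"

lemma pullbacks_deg0_eq_traces:
  assumes "group_action \<Gamma> (verts G) \<phi>" and "finite (carrier \<Gamma>)" and "finite (verts G)"
  shows "pullbacks_deg0 \<Gamma> G \<phi> \<psi> = divisor_trace \<Gamma> G \<phi> ` degree_zero_divisors G"
    (is "?P = ?T")
proof
  show "?P \<subseteq> ?T"
  proof
    fix f assume "f \<in> ?P"
    then obtain \<delta> where \<delta>: "\<delta> \<in> divisors (quotient_graph \<Gamma> G \<phi> \<psi>)"
      "divisor_degree (quotient_graph \<Gamma> G \<phi> \<psi>) \<delta> = 0" and f: "f = pullback \<Gamma> G \<phi> \<delta>"
      unfolding pullbacks_deg0_def by blast
    obtain \<epsilon> where "\<epsilon> \<in> divisors G" and \<epsilon>: "pushforward \<Gamma> G \<phi> \<epsilon> = \<delta>"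
      by (rule pushforward_surj[OF assms(1,3) \<delta>(1)])
    moreover have "divisor_degree G \<epsilon> = 0"
      using \<delta>(2) divisor_degree_pushforward[OF assms(1,3), of \<psi> \<epsilon>] by (simp add: \<epsilon>)
    moreover have "f = divisor_trace \<Gamma> G \<phi> \<epsilon>"
      using pullback_pushforward[OF assms(1,2), of \<epsilon>] by (simp add: f \<epsilon>)
    ultimately show "f \<in> ?T" by (auto simp: degree_zero_divisors_def)
  qed
  show "?T \<subseteq> ?P"
    using pushforward_in_divisors divisor_degree_pushforward[OF assms(1,3), of \<psi>]
    by (force simp: degree_zero_divisors_def pullbacks_deg0_def
        pullback_pushforward[OF assms(1,2), symmetric])
qed

section \<open>Groups generated by two involutions\<close>

context group
begin

definition involution :: "'a \<Rightarrow> bool" where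
  "involution \<sigma> \<longleftrightarrow> \<sigma> \<in> carrier G \<and> \<sigma> \<noteq> \<one> \<and> \<sigma> \<otimes> \<sigma> = \<one>"

lemma involution_inv: "involution \<sigma> \<Longrightarrow> inv \<sigma> = \<sigma>"
  by (simp add: involution_def inv_equality)

lemma ord_involution:
  assumes "involution \<sigma>"
  shows "ord \<sigma> = 2"
proof -
  have "ord \<sigma> dvd 2"
    using assms pow_eq_id[of \<sigma> 2] by (simp add: involution_def numeral_2_eq_2)
  moreover have "ord \<sigma> \<noteq> 1"
    using assms ord_eq_1 by (auto simp: involution_def)
  ultimately show ?thesis
    using two_is_prime_nat by (auto simp: prime_nat_iff)
qed

lemma involution_mult_int_pow:
  fixes k :: int
  assumes \<sigma>: "involution \<sigma>" and \<tau>: "involution \<tau>"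
  shows "\<sigma> \<otimes> (\<sigma> \<otimes> \<tau>) [^] k = (\<sigma> \<otimes> \<tau>) [^] (- k) \<otimes> \<sigma>"
proof -
  have in_carrier: "\<sigma> \<in> carrier G" "\<tau> \<in> carrier G"
    using \<sigma> \<tau> by (simp_all add: involution_def)
  have cancel: "\<sigma> \<otimes> (\<sigma> \<otimes> g) = g" if "g \<in> carrier G" for g
    using \<sigma> that by (simp add: involution_def m_assoc[symmetric])
  have "(\<lambda>g. \<sigma> \<otimes> g \<otimes> \<sigma>) \<in> hom G G"
    using in_carrier cancel by (auto simp: hom_def m_assoc)
  then have "\<sigma> \<otimes> (\<sigma> \<otimes> \<tau>) [^] k \<otimes> \<sigma> = (\<sigma> \<otimes> (\<sigma> \<otimes> \<tau>) \<otimes> \<sigma>) [^] k"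
    using in_carrier by (intro hom_int_pow) (auto simp: is_group)
  also have "\<sigma> \<otimes> (\<sigma> \<otimes> \<tau>) \<otimes> \<sigma> = inv (\<sigma> \<otimes> \<tau>)"
    using in_carrier \<sigma> \<tau> by (simp add: cancel inv_mult_group involution_inv)
  also have "inv (\<sigma> \<otimes> \<tau>) [^] k = (\<sigma> \<otimes> \<tau>) [^] (- k)"
    using in_carrier by (simp add: int_pow_inv int_pow_neg)
  finally have "\<sigma> \<otimes> (\<sigma> \<otimes> \<tau>) [^] k \<otimes> \<sigma> = (\<sigma> \<otimes> \<tau>) [^] (- k)" .
  then have "(\<sigma> \<otimes> \<tau>) [^] (- k) \<otimes> \<sigma> = \<sigma> \<otimes> (\<sigma> \<otimes> \<tau>) [^] k \<otimes> (\<sigma> \<otimes> \<sigma>)"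
    using in_carrier by (simp add: m_assoc[symmetric])
  then show ?thesis
    using in_carrier \<sigma> by (simp add: involution_def)
qed

lemma rotation_reflection_mult:
  fixes i j :: int
  assumes \<sigma>: "involution \<sigma>" and \<tau>: "involution \<tau>"
  defines "\<rho> \<equiv> \<sigma> \<otimes> \<tau>"
  shows "\<rho> [^] i \<otimes> (\<rho> [^] j \<otimes> \<sigma>) = \<rho> [^] (i + j) \<otimes> \<sigma>"
    and "(\<rho> [^] i \<otimes> \<sigma>) \<otimes> \<rho> [^] j = \<rho> [^] (i - j) \<otimes> \<sigma>"
    and "(\<rho> [^] i \<otimes> \<sigma>) \<otimes> (\<rho> [^] j \<otimes> \<sigma>) = \<rho> [^] (i - j)"
proof -
  have in_carrier: "\<sigma> \<in> carrier G" "\<rho> \<in> carrier G" and \<sigma>_sq: "\<sigma> \<otimes> \<sigma> = \<one>"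
    using \<sigma> \<tau> by (simp_all add: involution_def \<rho>_def)
  show "\<rho> [^] i \<otimes> (\<rho> [^] j \<otimes> \<sigma>) = \<rho> [^] (i + j) \<otimes> \<sigma>"
    using in_carrier by (simp add: int_pow_mult m_assoc)
  have "(\<rho> [^] i \<otimes> \<sigma>) \<otimes> \<rho> [^] j = \<rho> [^] i \<otimes> (\<rho> [^] (- j) \<otimes> \<sigma>)"
    using in_carrier involution_mult_int_pow[OF \<sigma> \<tau>, of j] by (simp add: \<rho>_def m_assoc)
  then show reflection_rotation: "(\<rho> [^] i \<otimes> \<sigma>) \<otimes> \<rho> [^] j = \<rho> [^] (i - j) \<otimes> \<sigma>"
    using in_carrier int_pow_mult[of \<rho> i "- j"] by (simp add: m_assoc)
  have "(\<rho> [^] i \<otimes> \<sigma>) \<otimes> (\<rho> [^] j \<otimes> \<sigma>) = (\<rho> [^] i \<otimes> \<sigma> \<otimes> \<rho> [^] j) \<otimes> \<sigma>"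
    using in_carrier by (simp add: m_assoc)
  then show "(\<rho> [^] i \<otimes> \<sigma>) \<otimes> (\<rho> [^] j \<otimes> \<sigma>) = \<rho> [^] (i - j)"
    using in_carrier \<sigma>_sq by (simp add: reflection_rotation m_assoc)
qed

lemma generate_mult_subset:
  assumes "a \<in> carrier G" and "b \<in> carrier G"
  shows "generate G {a \<otimes> b} \<subseteq> generate G {a, b}"
  using assms
  by (intro generate_subgroup_incl generate_is_subgroup) (auto intro: generate.eng generate.incl)

lemma generate_two_involutions:
  assumes \<sigma>: "involution \<sigma>" and \<tau>: "involution \<tau>"
  shows "generate G {\<sigma>, \<tau>} = generate G {\<sigma> \<otimes> \<tau>} \<union> (\<lambda>g. g \<otimes> \<sigma>) ` generate G {\<sigma> \<otimes> \<tau>}"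
proof -
  define \<rho> where "\<rho> = \<sigma> \<otimes> \<tau>"
  have in_carrier: "\<sigma> \<in> carrier G" "\<tau> \<in> carrier G" "\<rho> \<in> carrier G" and \<sigma>_sq: "\<sigma> \<otimes> \<sigma> = \<one>"
    using \<sigma> \<tau> by (simp_all add: involution_def \<rho>_def)
  let ?R = "range (\<lambda>k::int. \<rho> [^] k)" and ?S = "range (\<lambda>k::int. \<rho> [^] k \<otimes> \<sigma>)"
  have generate_\<rho>: "generate G {\<rho>} = ?R"
    using generate_pow[OF in_carrier(3)] by auto
  have "\<sigma> = \<rho> [^] (0::int) \<otimes> \<sigma>" and "\<tau> = \<rho> [^] (- 1 :: int) \<otimes> \<sigma>"
    using in_carrier \<sigma>_sq involution_mult_int_pow[OF \<sigma> \<tau>, of 1]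
    by (simp_all add: \<rho>_def m_assoc[symmetric])
  then have generators: "\<sigma> \<in> ?S" "\<tau> \<in> ?S" by blast+
  have "g \<in> ?R \<union> ?S" if "g \<in> generate G {\<sigma>, \<tau>}" for g
    using that
  proof induction
    case one
    have "\<one> = \<rho> [^] (0::int)" by simp
    then show ?case by blast
  next
    case (incl h)
    then show ?case using generators by blast
  next
    case (inv h)
    then show ?case using generators \<sigma> \<tau> by (auto simp: involution_inv)
  next
    case (eng g h)
    have "\<rho> [^] i \<otimes> \<rho> [^] j \<in> ?R" "\<rho> [^] i \<otimes> (\<rho> [^] j \<otimes> \<sigma>) \<in> ?S"
      "(\<rho> [^] i \<otimes> \<sigma>) \<otimes> \<rho> [^] j \<in> ?S" "(\<rho> [^] i \<otimes> \<sigma>) \<otimes> (\<rho> [^] j \<otimes> \<sigma>) \<in> ?R" for i j :: int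
      using rotation_reflection_mult[OF \<sigma> \<tau>, folded \<rho>_def]
        int_pow_mult[OF in_carrier(3), symmetric]
      by simp_all
    then show ?case using eng.IH by blast
  qed
  moreover have "?R \<union> ?S \<subseteq> generate G {\<sigma>, \<tau>}"
    using generate_mult_subset[OF in_carrier(1,2)] unfolding \<rho>_def[symmetric] generate_\<rho>
    by (auto intro: generate.eng generate.incl)
  ultimately show ?thesis
    unfolding \<rho>_def[symmetric] generate_\<rho> by auto
qed

lemma involution_notin_generate_mult:
  assumes \<sigma>: "involution \<sigma>" and \<tau>: "involution \<tau>"
  shows "\<sigma> \<notin> generate G {\<sigma> \<otimes> \<tau>}"
proof
  define \<rho> where "\<rho> = \<sigma> \<otimes> \<tau>"
  have in_carrier: "\<sigma> \<in> carrier G" "\<tau> \<in> carrier G" "\<rho> \<in> carrier G"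
    using \<sigma> \<tau> by (simp_all add: involution_def \<rho>_def)
  assume "\<sigma> \<in> generate G {\<sigma> \<otimes> \<tau>}"
  then obtain k :: int where \<sigma>_pow: "\<sigma> = \<rho> [^] k"
    using generate_pow[OF in_carrier(3)] by (auto simp: \<rho>_def)
  have "\<tau> = \<sigma> \<otimes> \<rho>"
    using \<sigma> in_carrier by (simp add: \<rho>_def involution_def m_assoc[symmetric])
  then have \<tau>_pow: "\<tau> = \<rho> [^] (k + 1)"
    using in_carrier by (simp add: int_pow_mult \<sigma>_pow[symmetric])
  have "\<rho> [^] (2 * k) = \<one>" "\<rho> [^] (2 * (k + 1)) = \<one>"
    using \<sigma> \<tau> in_carrier
    by (simp_all only: involution_def \<sigma>_pow[symmetric] \<tau>_pow[symmetric] int_pow_mult mult_2)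
  then have \<rho>_sq: "\<rho> [^] (2::int) = \<one>"
    using in_carrier int_pow_mult[of \<rho> "2 * k" 2] by (simp add: algebra_simps)
  have even_pow: "\<rho> [^] i = \<one>" if "even i" for i :: int
    using that in_carrier int_pow_pow[of \<rho> 2] \<rho>_sq by (auto elim!: evenE)
  show False
    using even_pow[of k] even_pow[of "k + 1"] \<sigma>_pow \<tau>_pow \<sigma> \<tau> by (auto simp: involution_def)
qed

lemma card_generate_two_involutions:
  assumes \<sigma>: "involution \<sigma>" and \<tau>: "involution \<tau>"
  shows "card (generate G {\<sigma>, \<tau>}) = 2 * ord (\<sigma> \<otimes> \<tau>)"
proof -
  have in_carrier: "\<sigma> \<in> carrier G" "\<sigma> \<otimes> \<tau> \<in> carrier G"
    using \<sigma> \<tau> by (simp_all add: involution_def)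
  let ?R = "generate G {\<sigma> \<otimes> \<tau>}" and ?S = "(\<lambda>g. g \<otimes> \<sigma>) ` generate G {\<sigma> \<otimes> \<tau>}"
  have subgroup_R: "subgroup ?R G"
    using in_carrier by (intro generate_is_subgroup) simp
  then have R_subset: "?R \<subseteq> carrier G"
    by (rule subgroup.subset)
  have "h \<otimes> \<sigma> \<notin> ?R" if "h \<in> ?R" for h
  proof
    assume "h \<otimes> \<sigma> \<in> ?R"
    then have "inv h \<otimes> (h \<otimes> \<sigma>) \<in> ?R"
      using subgroup_R that by (simp add: subgroup.m_closed subgroup.m_inv_closed)
    then show False
      using involution_notin_generate_mult[OF \<sigma> \<tau>] that R_subset in_carrier
      by (simp add: m_assoc[symmetric] subset_iff)
  qed
  then have "?R \<inter> ?S = {}" by auto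
  moreover have "card ?S = card ?R" and "finite ?S \<longleftrightarrow> finite ?R"
    using inj_on_subset[OF inj_on_multc[OF in_carrier(1)] R_subset]
    by (simp_all add: card_image finite_image_iff)
  ultimately have "card (?R \<union> ?S) = 2 * card ?R"
    by (cases "finite ?R") (simp_all add: card_Un_disjoint)
  then show ?thesis
    using in_carrier generate_two_involutions[OF \<sigma> \<tau>] generate_pow_card by simp
qed

lemma sum_generate_singleton:
  assumes "a \<in> carrier G" and "ord a > 0"
  shows "(\<Sum>g\<in>generate G {a}. f g) = (\<Sum>k<ord a. f (a [^] k))"
proof -
  have "{..<ord a} = {0..ord a - 1}"
    using assms(2) by auto
  then have "inj_on (\<lambda>k. a [^] k) {..<ord a}" and "generate G {a} = (\<lambda>k. a [^] k) ` {..<ord a}"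
    using assms ord_inj[OF assms(1)] generate_pow_nat ord_elems_inf_carrier by auto
  then show ?thesis by (simp add: sum.reindex)
qed

end

section \<open>Dihedral actions in coordinates\<close>

lemma (in group_action) one_act: "v \<in> E \<Longrightarrow> \<phi> \<one> v = v"
  using id_eq_one by (metis restrict_apply')

lemma (in group_action) group_action_subgroup_generated:
  "group_action (subgroup_generated G S) E \<phi>"
proof -
  interpret group G using group_hom group_hom.axioms(1) by blast
  show ?thesis
    unfolding subgroup_generated_def by (intro induced_action generate_is_subgroup) simp
qed

locale dihedral_cycle_graph = mirrored_cycles n C mirror
  for n :: nat and C :: "'c set" and mirror :: "'c \<Rightarrow> 'c" +
  fixes D :: "('g, 'm) monoid_scheme" and \<sigma>\<^sub>1 \<sigma>\<^sub>2 :: 'g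
    and G :: "('v, 'e) multigraph" and \<phi> :: "'g \<Rightarrow> 'v \<Rightarrow> 'v"
    and label :: "'c \<Rightarrow> int \<Rightarrow> 'v"
  assumes dihedral: "dihedral_group D n \<sigma>\<^sub>1 \<sigma>\<^sub>2"
    and action: "group_action D (verts G) \<phi>"
    and label_bij: "bij_betw (\<lambda>(c, i). label c i) (C \<times> {1..int n}) (verts G)"
    and label_periodic: "c \<in> C \<Longrightarrow> periodic_fun_simple (label c) (int n)"
    and label_\<sigma>\<^sub>1: "c \<in> C \<Longrightarrow> \<phi> \<sigma>\<^sub>1 (label c i) = label (mirror c) (1 - i)"
    and label_\<sigma>\<^sub>2: "c \<in> C \<Longrightarrow> \<phi> \<sigma>\<^sub>2 (label c i) = label (mirror c) (2 - i)"
begin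

sublocale group D
  using dihedral by (simp add: dihedral_group_def)

sublocale act: group_action D "verts G" \<phi>
  by (rule action)

abbreviation "\<rho> \<equiv> \<sigma>\<^sub>1 \<otimes>\<^bsub>D\<^esub> \<sigma>\<^sub>2"

definition coords :: "('v \<Rightarrow> int) \<Rightarrow> 'c \<Rightarrow> int \<Rightarrow> int" where
  "coords \<delta> c i = \<delta> (label c i)"

lemma involutions: "involution \<sigma>\<^sub>1" "involution \<sigma>\<^sub>2"
  using dihedral by (simp_all add: dihedral_group_def involution_def)

lemma generators_carrier: "\<sigma>\<^sub>1 \<in> carrier D" "\<sigma>\<^sub>2 \<in> carrier D"
  using involutions by (simp_all add: involution_def)

lemma ord_rotation: "ord \<rho> = n"
  using card_generate_two_involutions[OF involutions] dihedral
  by (simp add: dihedral_group_def order_def)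

lemma finite_verts: "finite (verts G)"
  using bij_betw_finite[OF label_bij] finite_C by simp

lemma finite_carrier_generated: "finite (carrier (subgroup_generated D S))"
proof (rule finite_subset)
  show "carrier (subgroup_generated D S) \<subseteq> carrier D"
    by (rule carrier_subgroup_generated_subset)
  show "finite (carrier D)"
    using dihedral n_pos by (auto simp: dihedral_group_def order_def intro: card_ge_0_finite)
qed

lemma ex_index_label:
  assumes "c \<in> C"
  obtains k where "k \<in> {1..int n}" and "[k = i] (mod int n)" and "label c k = label c i"
proof
  let ?k = "(i - 1) mod int n + 1"
  show "?k \<in> {1..int n}"
    using n_pos by (simp add: add1_zle_eq)
  show "[?k = i] (mod int n)"
    by (simp add: cong_def mod_simps)
  then show "label c ?k = label c i"
    by (rule periodic_cong[OF label_periodic[OF assms]])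
qed

lemma label_in_verts:
  assumes "c \<in> C"
  shows "label c i \<in> verts G"
proof -
  obtain k where "k \<in> {1..int n}" and k: "label c k = label c i"
    using ex_index_label[OF assms] by blast
  then have "label c k \<in> (\<lambda>(c, i). label c i) ` (C \<times> {1..int n})"
    using assms by (metis SigmaI case_prod_conv image_eqI)
  then show ?thesis
    using label_bij by (simp add: bij_betw_def k)
qed

lemma divisor_eqI_coords:
  assumes "\<delta> \<in> divisors G" and "\<epsilon> \<in> divisors G" and eq: "\<forall>c\<in>C. \<forall>i. coords \<delta> c i = coords \<epsilon> c i"
  shows "\<delta> = \<epsilon>"
proof
  fix v
  show "\<delta> v = \<epsilon> v"
  proof (cases "v \<in> verts G")
    case True
    then have "v \<in> (\<lambda>(c, i). label c i) ` (C \<times> {1..int n})"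
      using label_bij by (simp add: bij_betw_def)
    then obtain c i where "c \<in> C" "v = label c i" by auto
    then show ?thesis using eq by (simp add: coords_def)
  next
    case False
    then show ?thesis using assms(1,2) by (simp add: divisors_def)
  qed
qed

lemma periodic_coords: "periodic_array (coords \<delta>)"
  using label_periodic by (simp add: periodic_array_def periodic_fun_simple_def coords_def)

lemma total_coords: "total (coords \<delta>) = divisor_degree G \<delta>"
proof -
  have "divisor_degree G \<delta> = (\<Sum>(c, i)\<in>C \<times> {1..int n}. \<delta> (label c i))"
    unfolding divisor_degree_def
    by (subst sum.reindex_bij_betw[OF label_bij, symmetric]) (simp add: case_prod_unfold)
  then show ?thesis
    by (simp add: total_def cycle_sum_def coords_def sum.cartesian_product)
qed

lemma ex_divisor_coords:
  assumes a: "periodic_array a"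
  obtains \<delta> where "\<delta> \<in> divisors G" and "\<forall>c\<in>C. \<forall>i. coords \<delta> c i = a c i"
proof
  let ?label = "\<lambda>(c, i). label c i" and ?I = "C \<times> {1..int n}"
  define \<delta> where "\<delta> v = (if v \<in> verts G then case_prod a (the_inv_into ?I ?label v) else 0)" for v
  show "\<delta> \<in> divisors G"
    by (simp add: divisors_def \<delta>_def)
  show "\<forall>c\<in>C. \<forall>i. coords \<delta> c i = a c i"
  proof (intro ballI allI)
    fix c i assume "c \<in> C"
    obtain k where k: "k \<in> {1..int n}" "[k = i] (mod int n)" "label c k = label c i"
      by (rule ex_index_label[OF \<open>c \<in> C\<close>])
    have "the_inv_into ?I ?label (label c k) = (c, k)"
      using the_inv_into_f_f[of ?label ?I "(c, k)"] label_bij k(1) \<open>c \<in> C\<close>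
      by (simp add: bij_betw_def)
    then have "coords \<delta> c i = a c k"
      using label_in_verts[OF \<open>c \<in> C\<close>] by (simp add: coords_def \<delta>_def k(3)[symmetric])
    also have "\<dots> = a c i"
      using a \<open>c \<in> C\<close> by (intro periodic_cong[OF _ k(2)]) (simp add: periodic_array_def)
    finally show "coords \<delta> c i = a c i" .
  qed
qed

lemma coords_trace_involution:
  assumes \<sigma>: "involution \<sigma>" and label_\<sigma>: "\<And>c i. c \<in> C \<Longrightarrow> \<phi> \<sigma> (label c i) = label (mirror c) (k - i)"
    and "c \<in> C"
  shows "coords (divisor_trace (subgroup_generated D {\<sigma>}) G \<phi> \<delta>) c i
    = reflection_trace k (coords \<delta>) c i"
proof -
  have "\<sigma> \<in> carrier D"
    using \<sigma> by (simp add: involution_def)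
  then have "(\<Sum>g\<in>carrier (subgroup_generated D {\<sigma>}). \<delta> (\<phi> g (label c i)))
      = (\<Sum>j<2. \<delta> (\<phi> (\<sigma> [^]\<^bsub>D\<^esub> (j::nat)) (label c i)))"
    using sum_generate_singleton[of \<sigma>] ord_involution[OF \<sigma>]
    by (simp add: carrier_subgroup_generated)
  also have "\<dots> = \<delta> (label c i) + \<delta> (label (mirror c) (k - i))"
    using \<open>\<sigma> \<in> carrier D\<close> \<open>c \<in> C\<close> act.one_act[OF label_in_verts[OF \<open>c \<in> C\<close>]]
    by (simp add: numeral_2_eq_2 label_\<sigma>)
  finally show ?thesis
    using label_in_verts[OF \<open>c \<in> C\<close>]
    by (simp add: coords_def divisor_trace_def reflection_trace_def)
qed

lemma label_rotation_pow:
  assumes "c \<in> C"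
  shows "\<phi> (\<rho> [^]\<^bsub>D\<^esub> (k::nat)) (label c i) = label c (i - int k)"
proof (induction k arbitrary: i)
  case 0
  then show ?case using act.one_act label_in_verts[OF assms] by simp
next
  case (Suc k)
  have "\<phi> \<rho> (label c i) = label c (i - 1)"
    using act.composition_rule[OF label_in_verts[OF assms] generators_carrier]
    by (simp add: assms label_\<sigma>\<^sub>1 label_\<sigma>\<^sub>2 mirror_closed mirror_mirror)
  then have "\<phi> (\<rho> [^]\<^bsub>D\<^esub> Suc k) (label c i) = \<phi> (\<rho> [^]\<^bsub>D\<^esub> k) (label c (i - 1))"
    using act.composition_rule[OF label_in_verts[OF assms]] generators_carrier by simp
  then show ?case
    using Suc[of "i - 1"] by (simp add: algebra_simps)
qed

lemma coords_trace_rotation: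
  assumes "c \<in> C"
  shows "coords (divisor_trace (subgroup_generated D {\<rho>}) G \<phi> \<delta>) c i
    = rotation_trace (coords \<delta>) c i"
proof -
  have "(\<Sum>g\<in>generate D {\<rho>}. \<delta> (\<phi> g (label c i))) = (\<Sum>k<ord \<rho>. \<delta> (\<phi> (\<rho> [^]\<^bsub>D\<^esub> k) (label c i)))"
    using generators_carrier n_pos by (intro sum_generate_singleton) (simp_all add: ord_rotation)
  then have "(\<Sum>g\<in>carrier (subgroup_generated D {\<rho>}). \<delta> (\<phi> g (label c i)))
      = (\<Sum>k<n. coords \<delta> c (i - int k))"
    using generators_carrier assms
    by (simp add: carrier_subgroup_generated ord_rotation label_rotation_pow coords_def)
  also have "\<dots> = (\<Sum>i=1..int n. coords \<delta> c i)"
    using periodic_coords assms n_pos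
    by (intro sum_periodic_reindex) (auto simp: periodic_array_def inj_on_def)
  finally show ?thesis
    using label_in_verts[OF assms]
    by (simp add: coords_def divisor_trace_def rotation_trace_def cycle_sum_def)
qed

lemma coords_zero_total: "\<delta> \<in> degree_zero_divisors G \<Longrightarrow> coords \<delta> \<in> zero_total_arrays"
  by (simp add: degree_zero_divisors_def zero_total_arrays_def periodic_coords total_coords)

lemma ex_degree_zero_divisor_coords:
  assumes "a \<in> zero_total_arrays"
  shows "\<exists>\<delta>\<in>degree_zero_divisors G. \<forall>c\<in>C. \<forall>i. coords \<delta> c i = a c i"
proof -
  have "periodic_array a"
    using assms by (simp add: zero_total_arrays_def)
  then obtain \<delta> where "\<delta> \<in> divisors G" and coords: "\<forall>c\<in>C. \<forall>i. coords \<delta> c i = a c i"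
    by (rule ex_divisor_coords)
  moreover have "divisor_degree G \<delta> = 0"
    using assms coords total_coords[of \<delta>]
    by (simp add: zero_total_arrays_def total_def cycle_sum_def)
  ultimately show ?thesis
    by (auto simp: degree_zero_divisors_def)
qed

definition sum_of_traces :: "('v \<Rightarrow> int) \<Rightarrow> ('v \<Rightarrow> int) \<Rightarrow> ('v \<Rightarrow> int) \<Rightarrow> 'v \<Rightarrow> int" where
  "sum_of_traces \<delta>\<^sub>1 \<delta>\<^sub>2 \<delta>\<^sub>3 v = divisor_trace (subgroup_generated D {\<sigma>\<^sub>1}) G \<phi> \<delta>\<^sub>1 v
     + divisor_trace (subgroup_generated D {\<sigma>\<^sub>2}) G \<phi> \<delta>\<^sub>2 v
     + divisor_trace (subgroup_generated D {\<rho>}) G \<phi> \<delta>\<^sub>3 v"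

lemma pullback_sum_eq_traces:
  "pullback_sum D \<sigma>\<^sub>1 \<sigma>\<^sub>2 G \<phi> \<psi> = {sum_of_traces \<delta>\<^sub>1 \<delta>\<^sub>2 \<delta>\<^sub>3 | \<delta>\<^sub>1 \<delta>\<^sub>2 \<delta>\<^sub>3.
     \<delta>\<^sub>1 \<in> degree_zero_divisors G \<and> \<delta>\<^sub>2 \<in> degree_zero_divisors G \<and> \<delta>\<^sub>3 \<in> degree_zero_divisors G}"
proof -
  have "pullbacks_deg0 (subgroup_generated D S) G \<phi> \<psi>
      = divisor_trace (subgroup_generated D S) G \<phi> ` degree_zero_divisors G" for S
    by (intro pullbacks_deg0_eq_traces act.group_action_subgroup_generated finite_carrier_generated
        finite_verts)
  then show ?thesis
    by (fastforce simp: pullback_sum_def sum_of_traces_def[abs_def])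
qed

lemma coords_sum_of_traces:
  assumes "c \<in> C"
  shows "coords (sum_of_traces \<delta>\<^sub>1 \<delta>\<^sub>2 \<delta>\<^sub>3) c i = reflection_trace 1 (coords \<delta>\<^sub>1) c i
    + reflection_trace 2 (coords \<delta>\<^sub>2) c i + rotation_trace (coords \<delta>\<^sub>3) c i"
  using assms coords_trace_involution[OF involutions(1) label_\<sigma>\<^sub>1]
    coords_trace_involution[OF involutions(2) label_\<sigma>\<^sub>2] coords_trace_rotation
  by (simp add: coords_def sum_of_traces_def)

lemma pullback_sum_iff_is_trace_sum:
  assumes "\<delta> \<in> divisors G"
  shows "\<delta> \<in> pullback_sum D \<sigma>\<^sub>1 \<sigma>\<^sub>2 G \<phi> \<psi> \<longleftrightarrow> is_trace_sum (coords \<delta>)"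
proof
  assume "\<delta> \<in> pullback_sum D \<sigma>\<^sub>1 \<sigma>\<^sub>2 G \<phi> \<psi>"
  then obtain \<delta>\<^sub>1 \<delta>\<^sub>2 \<delta>\<^sub>3 where "\<delta> = sum_of_traces \<delta>\<^sub>1 \<delta>\<^sub>2 \<delta>\<^sub>3"
    "\<delta>\<^sub>1 \<in> degree_zero_divisors G" "\<delta>\<^sub>2 \<in> degree_zero_divisors G" "\<delta>\<^sub>3 \<in> degree_zero_divisors G"
    unfolding pullback_sum_eq_traces by blast
  then show "is_trace_sum (coords \<delta>)"
    using coords_zero_total coords_sum_of_traces unfolding is_trace_sum_def by blast
next
  assume "is_trace_sum (coords \<delta>)"
  then obtain a\<^sub>1 a\<^sub>2 a\<^sub>3 where
    a: "a\<^sub>1 \<in> zero_total_arrays" "a\<^sub>2 \<in> zero_total_arrays" "a\<^sub>3 \<in> zero_total_arrays"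
    and coords_\<delta>: "\<forall>c\<in>C. \<forall>i. coords \<delta> c i
      = reflection_trace 1 a\<^sub>1 c i + reflection_trace 2 a\<^sub>2 c i + rotation_trace a\<^sub>3 c i"
    unfolding is_trace_sum_def by blast
  obtain \<delta>\<^sub>1 \<delta>\<^sub>2 \<delta>\<^sub>3 where
    deg0: "\<delta>\<^sub>1 \<in> degree_zero_divisors G" "\<delta>\<^sub>2 \<in> degree_zero_divisors G" "\<delta>\<^sub>3 \<in> degree_zero_divisors G"
    and coords: "\<forall>c\<in>C. \<forall>i. coords \<delta>\<^sub>1 c i = a\<^sub>1 c i" "\<forall>c\<in>C. \<forall>i. coords \<delta>\<^sub>2 c i = a\<^sub>2 c i"
      "\<forall>c\<in>C. \<forall>i. coords \<delta>\<^sub>3 c i = a\<^sub>3 c i"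
    using a[THEN ex_degree_zero_divisor_coords] by blast
  have "\<delta> = sum_of_traces \<delta>\<^sub>1 \<delta>\<^sub>2 \<delta>\<^sub>3"
  proof (rule divisor_eqI_coords)
    show "sum_of_traces \<delta>\<^sub>1 \<delta>\<^sub>2 \<delta>\<^sub>3 \<in> divisors G"
      by (simp add: divisors_def sum_of_traces_def divisor_trace_def)
    show "\<forall>c\<in>C. \<forall>i. coords \<delta> c i = coords (sum_of_traces \<delta>\<^sub>1 \<delta>\<^sub>2 \<delta>\<^sub>3) c i"
      using coords_\<delta> coords mirror_closed
      by (simp add: coords_sum_of_traces reflection_trace_def rotation_trace_def cycle_sum_def)
  qed fact
  then show "\<delta> \<in> pullback_sum D \<sigma>\<^sub>1 \<sigma>\<^sub>2 G \<phi> \<psi>"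
    using deg0 unfolding pullback_sum_eq_traces by blast
qed

theorem pullback_sum_iff:
  assumes "\<delta> \<in> degree_zero_divisors G"
  shows "\<delta> \<in> pullback_sum D \<sigma>\<^sub>1 \<sigma>\<^sub>2 G \<phi> \<psi> \<longleftrightarrow> [weight (coords \<delta>) = 0] (mod int n) \<and> balanced (coords \<delta>)"
  using assms pullback_sum_iff_is_trace_sum is_trace_sum_iff[OF coords_zero_total]
  by (simp add: degree_zero_divisors_def)

end

section \<open>Dihedral labellings\<close>

datatype cycle = X_cycle nat | Y_cycle nat | Z_cycle nat

primrec mirror_cycle :: "cycle \<Rightarrow> cycle" where
  "mirror_cycle (X_cycle j) = Y_cycle j"
| "mirror_cycle (Y_cycle j) = X_cycle j"
| "mirror_cycle (Z_cycle j) = Z_cycle j"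

primrec cycle_label ::
  "(int \<Rightarrow> nat \<Rightarrow> 'v) \<Rightarrow> (int \<Rightarrow> nat \<Rightarrow> 'v) \<Rightarrow> (int \<Rightarrow> nat \<Rightarrow> 'v) \<Rightarrow> cycle \<Rightarrow> int \<Rightarrow> 'v"
where
  "cycle_label x y z (X_cycle j) = (\<lambda>i. x i j)"
| "cycle_label x y z (Y_cycle j) = (\<lambda>i. y i j)"
| "cycle_label x y z (Z_cycle j) = (\<lambda>i. z i j)"

definition cycles :: "nat \<Rightarrow> nat \<Rightarrow> cycle set" where
  "cycles s t = X_cycle ` {1..t} \<union> Y_cycle ` {1..t} \<union> Z_cycle ` {1..s}"

lemma finite_cycles: "finite (cycles s t)"
  by (simp add: cycles_def)

lemma sum_cycles:
  "(\<Sum>c\<in>cycles s t. F c)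
    = (\<Sum>j=1..t. F (X_cycle j)) + (\<Sum>j=1..t. F (Y_cycle j)) + (\<Sum>j=1..s. F (Z_cycle j))"
proof -
  have "(\<Sum>c\<in>cycles s t. F c)
      = (\<Sum>c\<in>X_cycle ` {1..t}. F c) + (\<Sum>c\<in>Y_cycle ` {1..t}. F c) + (\<Sum>c\<in>Z_cycle ` {1..s}. F c)"
    unfolding cycles_def by (subst sum.union_disjoint; auto)+
  then show ?thesis
    by (simp add: sum.reindex inj_on_def)
qed

lemma ball_cycles:
  "(\<forall>c\<in>cycles s t. P c) \<longleftrightarrow>
     (\<forall>j\<in>{1..t}. P (X_cycle j)) \<and> (\<forall>j\<in>{1..t}. P (Y_cycle j)) \<and> (\<forall>j\<in>{1..s}. P (Z_cycle j))"
  by (auto simp: cycles_def)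

lemma card_verts_labelling:
  assumes "group_action D (verts G) \<phi>" and "finite (verts G)" and "n > 0"
    and sizes: "\<forall>B\<in>orbits D (verts G) \<phi>. card B = n \<or> card B = 2 * n"
    and labelling: "dihedral_labelling D n \<sigma>\<^sub>1 \<sigma>\<^sub>2 G \<phi> s t z x y"
  shows "card (verts G) = (s + 2 * t) * n"
proof -
  interpret group_action D "verts G" \<phi> by fact
  let ?small = "{B \<in> orbits D (verts G) \<phi>. card B = n}"
  let ?large = "{B \<in> orbits D (verts G) \<phi>. card B = 2 * n}"
  have card: "card ?small = s" "card ?large = t"
    using labelling by (auto simp: dihedral_labelling_def dest!: bij_betw_same_card)
  have finite: "finite (orbits D (verts G) \<phi>)"
    using assms(2) by (simp add: orbits_def)
  have "card (verts G) = (\<Sum>B\<in>orbits D (verts G) \<phi>. card B)"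
    using disjoint_sum[OF assms(2), of "\<lambda>_. 1 :: nat"] by simp
  also have "orbits D (verts G) \<phi> = ?small \<union> ?large"
    using sizes by auto
  also have "(\<Sum>B\<in>?small \<union> ?large. card B) = (\<Sum>B\<in>?small. card B) + (\<Sum>B\<in>?large. card B)"
    using finite \<open>n > 0\<close> by (intro sum.union_disjoint) auto
  also have "\<dots> = (\<Sum>B\<in>?small. n) + (\<Sum>B\<in>?large. 2 * n)"
    by simp
  also have "\<dots> = (s + 2 * t) * n"
    by (simp only: sum_constant card) (simp add: algebra_simps)
  finally show ?thesis .
qed

lemma bij_betw_cycle_label:
  fixes G :: "('v, 'e) multigraph"
  assumes "group_action D (verts G) \<phi>" and "finite (verts G)" and "n > 0"
    and sizes: "\<forall>B\<in>orbits D (verts G) \<phi>. card B = n \<or> card B = 2 * n"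
    and labelling: "dihedral_labelling D n \<sigma>\<^sub>1 \<sigma>\<^sub>2 G \<phi> s t z x y"
  shows "bij_betw (\<lambda>(c, i). cycle_label x y z c i) (cycles s t \<times> {1..int n}) (verts G)"
proof -
  interpret group_action D "verts G" \<phi> by fact
  let ?label = "\<lambda>(c, i). cycle_label x y z c i" and ?I = "cycles s t \<times> {1..int n}"
  have image_eq: "{f i | i. i \<in> {1..int n}} = f ` {1..int n}" for f :: "int \<Rightarrow> 'v"
    by auto
  have "(\<Union>j\<in>{1..s}. (\<lambda>i. z i j) ` {1..int n}) = \<Union> {B \<in> orbits D (verts G) \<phi>. card B = n}"
    "(\<Union>j\<in>{1..t}. (\<lambda>i. x i j) ` {1..int n} \<union> (\<lambda>i. y i j) ` {1..int n})
      = \<Union> {B \<in> orbits D (verts G) \<phi>. card B = 2 * n}"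
    using labelling unfolding dihedral_labelling_def bij_betw_def image_eq by simp_all
  moreover have "verts G = \<Union> {B \<in> orbits D (verts G) \<phi>. card B = n}
      \<union> \<Union> {B \<in> orbits D (verts G) \<phi>. card B = 2 * n}"
    using orbits_coverture sizes by blast
  ultimately have "verts G = (\<Union>j\<in>{1..t}. (\<lambda>i. x i j) ` {1..int n})
      \<union> (\<Union>j\<in>{1..t}. (\<lambda>i. y i j) ` {1..int n}) \<union> (\<Union>j\<in>{1..s}. (\<lambda>i. z i j) ` {1..int n})"
    by (simp add: UN_Un_distrib Un_ac)
  also have "\<dots> = (\<Union>c\<in>cycles s t. cycle_label x y z c ` {1..int n})"
    by (simp add: cycles_def image_Un image_image)
  finally have image: "?label ` ?I = verts G"
    by auto
  have "card ?I = card (verts G)"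
    using card_verts_labelling[OF assms] sum_cycles[of "\<lambda>_. 1 :: nat" s t]
    by (simp add: card_cartesian_product)
  then show ?thesis
    unfolding bij_betw_def using image finite_cycles by (simp add: eq_card_imp_inj_on)
qed

lemma dihedral_cycle_graph_labelling:
  assumes "odd n" and "dihedral_group D n \<sigma>\<^sub>1 \<sigma>\<^sub>2"
    and "finite (verts G)" and "verts G \<noteq> {}" and "group_action D (verts G) \<phi>"
    and "\<forall>B\<in>orbits D (verts G) \<phi>. card B = n \<or> card B = 2 * n"
    and labelling: "dihedral_labelling D n \<sigma>\<^sub>1 \<sigma>\<^sub>2 G \<phi> s t z x y"
  shows "dihedral_cycle_graph n (cycles s t) mirror_cycle D \<sigma>\<^sub>1 \<sigma>\<^sub>2 G \<phi> (cycle_label x y z)"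
proof (intro dihedral_cycle_graph.intro mirrored_cycles.intro dihedral_cycle_graph_axioms.intro)
  have n_pos: "n > 0" using \<open>odd n\<close> by (rule odd_pos)
  show "bij_betw (\<lambda>(c, i). cycle_label x y z c i) (cycles s t \<times> {1..int n}) (verts G)"
    by (rule bij_betw_cycle_label) (use assms n_pos in auto)
  then show "cycles s t \<noteq> {}"
    using \<open>verts G \<noteq> {}\<close> by (auto simp: bij_betw_def)
  have mirror: "mirror_cycle c \<in> cycles s t" "mirror_cycle (mirror_cycle c) = c"
    if "c \<in> cycles s t" for c
    using that by (auto simp: cycles_def)
  have periodic: "periodic_fun_simple (cycle_label x y z c) (int n)" if "c \<in> cycles s t" for c
    using that labelling by (auto simp: cycles_def dihedral_labelling_def periodic_fun_simple_def)
  fix c i assume c_in: "c \<in> cycles s t"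
  show "mirror_cycle c \<in> cycles s t" "mirror_cycle (mirror_cycle c) = c"
    "periodic_fun_simple (cycle_label x y z c) (int n)"
    using mirror periodic c_in by auto
  interpret periodic_fun_simple "cycle_label x y z (mirror_cycle c)" "int n"
    by (intro periodic mirror c_in)
  have shift: "cycle_label x y z (mirror_cycle c) (int n + k - i)
      = cycle_label x y z (mirror_cycle c) (k - i)" for k
    using plus_1[of "k - i"] by (simp add: algebra_simps)
  have "\<phi> \<sigma>\<^sub>1 (cycle_label x y z c i) = cycle_label x y z (mirror_cycle c) (int n + 1 - i)"
    and "\<phi> \<sigma>\<^sub>2 (cycle_label x y z c i) = cycle_label x y z (mirror_cycle c) (int n + 2 - i)"
    using c_in labelling by (auto simp: cycles_def dihedral_labelling_def)
  then show "\<phi> \<sigma>\<^sub>1 (cycle_label x y z c i) = cycle_label x y z (mirror_cycle c) (1 - i)"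
    and "\<phi> \<sigma>\<^sub>2 (cycle_label x y z c i) = cycle_label x y z (mirror_cycle c) (2 - i)"
    by (simp_all only: shift)
qed (use assms finite_cycles in auto)

theorem theorem3p3:
  fixes D :: "('g, 'm) monoid_scheme" and n :: nat and \<sigma>\<^sub>1 \<sigma>\<^sub>2 :: 'g
    and G :: "('v, 'e) multigraph"
    and \<phi> :: "'g \<Rightarrow> 'v \<Rightarrow> 'v" and \<psi> :: "'g \<Rightarrow> 'e \<Rightarrow> 'e"
    and s t :: nat and z x y :: "int \<Rightarrow> nat \<Rightarrow> 'v"
    and \<delta> :: "'v \<Rightarrow> int"
  assumes "odd n"
    and "dihedral_group D n \<sigma>\<^sub>1 \<sigma>\<^sub>2"
    and "finite_loopless_graph G" and "connected_graph G"
    and "harmonic_action D G \<phi> \<psi>"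
    and "\<forall>B\<in>orbits D (verts G) \<phi>. card B = n \<or> card B = 2 * n"
    and "dihedral_labelling D n \<sigma>\<^sub>1 \<sigma>\<^sub>2 G \<phi> s t z x y"
    and "\<delta> \<in> divisors G" and "divisor_degree G \<delta> = 0"
  shows "\<delta> \<in> pullback_sum D \<sigma>\<^sub>1 \<sigma>\<^sub>2 G \<phi> \<psi> \<longleftrightarrow>
    [(\<Sum>i=1..int n. i * ((\<Sum>j=1..t. \<delta> (x i j)) + (\<Sum>j=1..t. \<delta> (y i j)) + (\<Sum>j=1..s. \<delta> (z i j)))) = 0]
      (mod int n) \<and>
    (\<forall>j\<in>{1..t}. [(\<Sum>i=1..int n. \<delta> (x i j)) = (\<Sum>i=1..int n. \<delta> (y i j))] (mod int n))"
proof -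
  interpret dihedral_cycle_graph n "cycles s t" mirror_cycle D \<sigma>\<^sub>1 \<sigma>\<^sub>2 G \<phi> "cycle_label x y z"
    using assms
    by (intro dihedral_cycle_graph_labelling)
       (auto simp: finite_loopless_graph_def connected_graph_def harmonic_action_def
         graph_action_def)
  have "weight (coords \<delta>) = (\<Sum>i=1..int n. \<Sum>c\<in>cycles s t. i * coords \<delta> c i)"
    unfolding weight_def by (rule sum.swap)
  also have "\<dots> = (\<Sum>i=1..int n.
      i * ((\<Sum>j=1..t. \<delta> (x i j)) + (\<Sum>j=1..t. \<delta> (y i j)) + (\<Sum>j=1..s. \<delta> (z i j))))"
    by (simp add: sum_cycles coords_def distrib_left sum_distrib_left)
  finally have weight: "weight (coords \<delta>) = \<dots>" .
  have "balanced (coords \<delta>) \<longleftrightarrow>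
      (\<forall>j\<in>{1..t}. [(\<Sum>i=1..int n. \<delta> (x i j)) = (\<Sum>i=1..int n. \<delta> (y i j))] (mod int n))"
    unfolding balanced_def cycle_sum_def coords_def
    by (simp add: ball_cycles) (auto simp: cong_sym_eq)
  then show ?thesis
    using assms(8,9) pullback_sum_iff[of \<delta>] by (simp add: degree_zero_divisors_def weight)
qed

end
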